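(* Let $X=(X_s)_{s\ge0}$ be a rate-1 simple random walk on $\mathbb{Z}$ started at $0$. Uniformly in $s\in(0,\infty)$ and in $r\ge\sqrt{s}$ with $r\in\mathbb{Z}$, $$-\log\mathbb{P}(X_s\ge r)\asymp r\,\min\{r/s,1\}\,\log\bigl(\max\{r/s,e\}\bigr),$$ $$\mathbb{P}(X_s\ge r)\big/\mathbb{P}(X_s=r)\asymp\max\{s/r,1\}.$$
   Context: The rate-1 simple random walk on $\mathbb{Z}$ is the continuous-time walk which jumps at rate 1, each jump being $+1$ or $-1$ with probability $1/2$ each. $a\asymp b$ uniformly over a set of parameters means that there are universal constants $0<c\le C<\infty$ with $cb\le a\le Cb$ for all parameter values in that set. Logarithms are natural. *)

theory Defs
  imports "HOL-Probability.Probability"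
begin

text \<open>\<open>\<tau> n\<close> is the waiting time before the jump with index \<open>n\<close> (starting at \<open>0\<close>), so
  this is the number of jumps made up to and including time \<open>s\<close>.  The set is finite for
  every \<open>s\<close> almost surely when the waiting times are i.i.d. exponential; on the remaining
  null set \<open>card\<close> gives the junk value \<open>0\<close>.\<close>

definition jump_count :: "(nat \<Rightarrow> 'a \<Rightarrow> real) \<Rightarrow> real \<Rightarrow> 'a \<Rightarrow> nat" where
  "jump_count \<tau> s \<omega> = card {n. (\<Sum>i\<le>n. \<tau> i \<omega>) \<le> s}"

text \<open>\<open>rate_one_srw M x X\<close>: on the probability space \<open>M\<close>, the process \<open>X\<close> is a rate-1 simple
  random walk on the integers started at \<open>x\<close>.  The waiting times \<open>\<tau>\<close> and the steps \<open>\<xi>\<close> are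
  jointly independent; the library's \<open>indep_vars\<close> wants one family with a common value
  type, hence the sum-indexed family and the embedding of the steps into the reals.
  The path is only required to agree almost surely with the one built from \<open>\<tau>\<close> and \<open>\<xi>\<close>, with
  one null set for all times, so measurability of \<open>X s\<close> is a separate condition.\<close>

definition rate_one_srw :: "'a measure \<Rightarrow> int \<Rightarrow> (real \<Rightarrow> 'a \<Rightarrow> int) \<Rightarrow> bool" where
  "rate_one_srw M x X \<longleftrightarrow>
     prob_space M \<and>
     (\<forall>s\<ge>0. X s \<in> measurable M (count_space UNIV)) \<and>
     (\<exists>\<tau> \<xi>.
        prob_space.indep_vars M (\<lambda>_. borel)
          (case_sum \<tau> (\<lambda>n \<omega>. real_of_int (\<xi> n \<omega>))) (UNIV :: (nat + nat) set) \<and>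
        (\<forall>n. distributed M lborel (\<tau> n) (exponential_density 1)) \<and>
        (\<forall>n. \<P>(\<omega> in M. \<xi> n \<omega> = 1) = 1 / 2 \<and> \<P>(\<omega> in M. \<xi> n \<omega> = - 1) = 1 / 2) \<and>
        (AE \<omega> in M. \<forall>s\<ge>0. X s \<omega> = x + (\<Sum>i<jump_count \<tau> s \<omega>. \<xi> i \<omega>)))"

definition asymp_on :: "'p set \<Rightarrow> ('p \<Rightarrow> real) \<Rightarrow> ('p \<Rightarrow> real) \<Rightarrow> bool" where
  "asymp_on P a b \<longleftrightarrow>
     (\<exists>c C. 0 < c \<and> c \<le> C \<and> (\<forall>p\<in>P. c * b p \<le> a p \<and> a p \<le> C * b p))"

text \<open>The walk itself (probability space and process) is made one of the parameters, so
  that the constants of \<open>asymp_on\<close> do not depend on which realisation of the walk is taken.\<close>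

definition srw_tail_params :: "('a measure \<times> (real \<Rightarrow> 'a \<Rightarrow> int) \<times> real \<times> int) set" where
  "srw_tail_params =
     {(M, X, s, r). rate_one_srw M 0 X \<and> 0 < s \<and> sqrt s \<le> real_of_int r}"

end

theory Submission imports Defs begin

text \<open>
  The number of jumps up to time \<open>s\<close> is Poisson and independent of the steps, so \<open>X\<^sub>s\<close> has the
  explicit law \<open>P(X\<^sub>s = k) = exp (- s) * I\<^sub>k(s)\<close> for \<open>k \<ge> 0\<close> and is symmetric, where \<open>I\<^sub>k\<close> is the
  modified Bessel function (\<open>rate_one_srw_point_prob\<close>).  Everything then follows from good
  two-sided bounds on the ratio \<open>\<rho>\<^sub>k\<close> of the probabilities of \<open>k + 1\<close> and \<open>k\<close>.  The three-term
  recurrence of the Bessel functions reads \<open>1 / \<rho>\<^sub>k = 2 (k + 1) / s + \<rho>\<^sub>k\<^sub>+\<^sub>1\<close>, and log-concavity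
  in the order (\<open>bessel_I_log_concave\<close>) says that \<open>\<rho>\<close> is decreasing; replacing one of the two
  ratios by the other turns the recurrence into a quadratic inequality for a single ratio, whence
  \<open>exp (- (k + 1) / s) \<le> \<rho>\<^sub>k \<le> s / (s + k)\<close>, the upper bound for \<open>k \<ge> 1\<close>.
  The recurrence alone also gives \<open>\<rho>\<^sub>k \<le> s / (2 (k + 1))\<close>.

  For the comparison of \<open>P(X\<^sub>s \<ge> r)\<close> with \<open>P(X\<^sub>s = r)\<close>, the upper bound on the ratio makes the
  tail at most a geometric series with sum \<open>1 + s / r\<close>.  Conversely, by the lower bound on the
  ratio the point probabilities lose at most a factor \<open>exp 2\<close> over the \<open>s / r\<close> integers that
  follow \<open>r\<close>; the hypothesis \<open>r \<ge> sqrt s\<close> is what keeps these integers below \<open>2 r\<close>.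

  For the logarithm there are two regimes.  When \<open>r\<close> is at most of order \<open>s\<close>, multiplying the
  ratio bounds gives the Gaussian form: an upper bound \<open>exp (- r (r - 1) / (8 s))\<close> times
  \<open>P(X\<^sub>s \<ge> 1) \<le> 1 / 2\<close>, and a lower bound by comparing the blocks \<open>[0, r)\<close> and \<open>[r, 2 r)\<close>, which
  shows that \<open>P(X\<^sub>s \<ge> r)\<close> is at least \<open>exp (- 2 r\<^sup>2 / s) / 2\<close> times \<open>P(X\<^sub>s \<ge> 0) \<ge> 1 / 2\<close>.
  For larger \<open>r\<close> the Poisson-type bounds \<open>(s / 2)\<^sup>r / r!\<close> from above and
  \<open>exp (- s) (s / 2)\<^sup>r / r!\<close> from below are sharp enough.
\<close>

section \<open>Modified Bessel functions of integer order\<close>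

definition bessel_I :: "nat \<Rightarrow> real \<Rightarrow> real" where
  "bessel_I k s = (\<Sum>m. (s / 2) ^ (2 * m + k) / (fact m * fact (m + k)))"

lemma bessel_I_summable:
  fixes s :: real
  shows "summable (\<lambda>m. norm ((s / 2) ^ (2 * m + k) / (fact m * fact (m + k))))"
proof (rule summable_comparison_test)
  show "\<exists>N. \<forall>m\<ge>N. norm (norm ((s / 2) ^ (2 * m + k) / (fact m * fact (m + k))))
      \<le> \<bar>s / 2\<bar> ^ k * (inverse (fact m) * ((s / 2)\<^sup>2) ^ m)"
  proof (intro exI allI impI)
    fix m :: nat
    have "1 \<le> (fact (m + k) :: real)" by simp
    hence "\<bar>s / 2\<bar> ^ (2 * m + k) / (fact m * fact (m + k)) \<le> \<bar>s / 2\<bar> ^ (2 * m + k) / (fact m * 1)"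
      by (intro divide_left_mono mult_left_mono mult_pos_pos) auto
    also have "\<dots> = \<bar>s / 2\<bar> ^ k * (inverse (fact m) * ((s / 2)\<^sup>2) ^ m)"
      unfolding power_add power_mult power2_abs by (simp only: divide_inverse mult_1_left mult_1_right mult_ac)
    finally show "norm (norm ((s / 2) ^ (2 * m + k) / (fact m * fact (m + k))))
        \<le> \<bar>s / 2\<bar> ^ k * (inverse (fact m) * ((s / 2)\<^sup>2) ^ m)"
      by (simp only: real_norm_def abs_idempotent abs_divide abs_mult power_abs abs_of_nonneg[OF fact_ge_zero])
  qed
  show "summable (\<lambda>m. \<bar>s / 2\<bar> ^ k * (inverse (fact m) * ((s / 2)\<^sup>2) ^ m))"
    by (intro summable_mult summable_exp)
qed

lemma bessel_I_sums:
  "(\<lambda>m. (s / 2) ^ (2 * m + k) / (fact m * fact (m + k))) sums bessel_I k s"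
  unfolding bessel_I_def using summable_norm_cancel[OF bessel_I_summable] by (rule summable_sums)

lemma bessel_I_ge_leading:
  assumes "0 < s"
  shows "(s / 2) ^ k / fact k \<le> bessel_I k s"
  using sum_le_suminf[OF sums_summable[OF bessel_I_sums[of s k]], of "{0}"] assms
  by (simp add: bessel_I_def)

lemma bessel_I_pos: "0 < s \<Longrightarrow> 0 < bessel_I k s"
  by (rule less_le_trans[OF _ bessel_I_ge_leading]) auto

lemma bessel_I_recurrence:
  "s / 2 * bessel_I k s = real (k + 1) * bessel_I (k + 1) s + s / 2 * bessel_I (k + 2) s"
proof -
  let ?t = "\<lambda>m. (s / 2) ^ (2 * m + (k + 1)) / (fact m * fact (m + (k + 1)))"
  let ?u = "\<lambda>m. real m * ?t m"
  have "(\<lambda>m. s / 2 * ((s / 2) ^ (2 * m + (k + 2)) / (fact m * fact (m + (k + 2))))) sums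
      (s / 2 * bessel_I (k + 2) s)"
    by (intro sums_mult bessel_I_sums)
  also have "(\<lambda>m. s / 2 * ((s / 2) ^ (2 * m + (k + 2)) / (fact m * fact (m + (k + 2))))) =
      (\<lambda>m. ?u (Suc m))"
  proof
    fix m
    have *: "2 * Suc m + (k + 1) = Suc (2 * m + (k + 2))" "Suc m + (k + 1) = m + (k + 2)" by simp_all
    show "s / 2 * ((s / 2) ^ (2 * m + (k + 2)) / (fact m * fact (m + (k + 2)))) = ?u (Suc m)"
      unfolding * fact_Suc power_Suc mult.assoc times_divide_eq_right
      by (rule mult_divide_mult_cancel_left[symmetric]) simp
  qed
  finally have "?u sums (s / 2 * bessel_I (k + 2) s + ?u 0)" by (rule sums_Suc)
  hence sum_t: "(\<lambda>m. real (k + 1) * ?t m + ?u m) sums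
      (real (k + 1) * bessel_I (k + 1) s + s / 2 * bessel_I (k + 2) s)"
    by (intro sums_add sums_mult bessel_I_sums) simp
  have eq: "(\<lambda>m. real (k + 1) * ?t m + ?u m) =
      (\<lambda>m. s / 2 * ((s / 2) ^ (2 * m + k) / (fact m * fact (m + k))))"
  proof
    fix m
    have *: "2 * m + (k + 1) = Suc (2 * m + k)" "m + (k + 1) = Suc (m + k)" by simp_all
    have "real (k + 1) * x + real m * x = real (Suc (m + k)) * x" for x
      by (simp add: algebra_simps)
    hence "real (k + 1) * ?t m + ?u m = real (Suc (m + k)) * ?t m" .
    also have "\<dots> = s / 2 * ((s / 2) ^ (2 * m + k) / (fact m * fact (m + k)))"
      unfolding * fact_Suc power_Suc times_divide_eq_right mult.left_commute[of "fact m"]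
      by (rule mult_divide_mult_cancel_left) simp
    finally show "real (k + 1) * ?t m + ?u m = s / 2 * ((s / 2) ^ (2 * m + k) / (fact m * fact (m + k)))" .
  qed
  have "(\<lambda>m. s / 2 * ((s / 2) ^ (2 * m + k) / (fact m * fact (m + k)))) sums (s / 2 * bessel_I k s)"
    by (intro sums_mult bessel_I_sums)
  thus ?thesis by (rule sums_unique2[OF _ sum_t[unfolded eq]])
qed

text \<open>The Cauchy product of the two series; Vandermonde's identity evaluates its inner sum.\<close>

lemma bessel_I_mult_sums:
  "(\<lambda>m. real ((2 * m + k + l) choose m) * (s / 2) ^ (2 * m + k + l) / (fact (m + k) * fact (m + l)))
     sums (bessel_I k s * bessel_I l s)"
proof -
  let ?b = "\<lambda>k m. (s / 2) ^ (2 * m + k) / (fact m * fact (m + k))"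
  have "(\<lambda>m. \<Sum>i\<le>m. ?b k i * ?b l (m - i)) sums (bessel_I k s * bessel_I l s)"
    unfolding bessel_I_def by (rule Cauchy_product_sums[OF bessel_I_summable bessel_I_summable])
  moreover have "(\<Sum>i\<le>m. ?b k i * ?b l (m - i)) =
      real ((2 * m + k + l) choose m) * (s / 2) ^ (2 * m + k + l) / (fact (m + k) * fact (m + l))" for m
  proof -
    have "?b k i * ?b l (m - i) = (s / 2) ^ (2 * m + k + l) / (fact (m + k) * fact (m + l)) *
        real (((m + l) choose i) * ((m + k) choose (m - i)))" if le: "i \<le> m" for i
    proof -
      obtain j where m: "m = i + j" using le le_Suc_ex by blast
      have bin1: "real ((m + l) choose i) = fact (m + l) / (fact i * fact (j + l))"
        using binomial_fact[of i "m + l", where 'a = real] by (simp add: m)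
      have bin2: "real ((m + k) choose (m - i)) = fact (m + k) / (fact j * fact (i + k))"
        using binomial_fact[of j "m + k", where 'a = real] by (simp add: m)
      have pow: "(s / 2) ^ (2 * m + k + l) = (s / 2) ^ (2 * i + k) * (s / 2) ^ (2 * j + l)"
        unfolding m power_add[symmetric] by (rule arg_cong[where f = "(^) (s / 2)"]) simp
      have regroup: "x / (f * f') * (y / (g * g')) = x * y / (F * G) * (G / (f * g') * (F / (g * f')))"
        if "F \<noteq> 0" "G \<noteq> 0" for x y f f' g g' F G :: real
        using that by simp
      have "m - i = j" by (simp add: m)
      thus ?thesis
        unfolding of_nat_mult bin1 bin2 pow by (simp only: regroup[OF fact_nonzero fact_nonzero])
    qed
    hence "(\<Sum>i\<le>m. ?b k i * ?b l (m - i)) = (s / 2) ^ (2 * m + k + l) / (fact (m + k) * fact (m + l)) *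
        real (\<Sum>i\<le>m. ((m + l) choose i) * ((m + k) choose (m - i)))"
      unfolding of_nat_sum sum_distrib_left by (intro sum.cong) auto
    also have "(\<Sum>i\<le>m. ((m + l) choose i) * ((m + k) choose (m - i))) = (2 * m + k + l) choose m"
      by (subst vandermonde) (simp add: mult_2 add_ac)
    finally show ?thesis by (simp add: mult.commute)
  qed
  ultimately show ?thesis by simp
qed

text \<open>By the product formula both sides are series with the same binomial numerators, and
  \<open>(m + k)! (m + k + 2)! \<ge> ((m + k + 1)!)\<^sup>2\<close> compares them term by term.\<close>

lemma bessel_I_log_concave:
  assumes "0 < s"
  shows "bessel_I k s * bessel_I (k + 2) s \<le> (bessel_I (k + 1) s)\<^sup>2"
proof (rule sums_le)
  show "(\<lambda>m. real ((2 * m + k + (k + 2)) choose m) * (s / 2) ^ (2 * m + k + (k + 2)) /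
      (fact (m + k) * fact (m + (k + 2)))) sums (bessel_I k s * bessel_I (k + 2) s)"
    by (rule bessel_I_mult_sums)
  show "(\<lambda>m. real ((2 * m + (k + 1) + (k + 1)) choose m) * (s / 2) ^ (2 * m + (k + 1) + (k + 1)) /
      (fact (m + (k + 1)) * fact (m + (k + 1)))) sums ((bessel_I (k + 1) s)\<^sup>2)"
    unfolding power2_eq_square by (rule bessel_I_mult_sums)
  fix m
  have "(fact (m + (k + 1)) * fact (m + (k + 1)) :: real) = fact (m + k) * fact (m + k) * (real (m + k) + 1) * (real (m + k) + 1)"
    by (simp add: algebra_simps)
  also have "\<dots> \<le> fact (m + k) * fact (m + k) * (real (m + k) + 1) * (real (m + k) + 2)"
    by (intro mult_left_mono) auto
  also have "\<dots> = fact (m + k) * fact (m + (k + 2))"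
    by (simp add: algebra_simps)
  finally have le: "(fact (m + (k + 1)) * fact (m + (k + 1)) :: real) \<le> fact (m + k) * fact (m + (k + 2))" .
  have "2 * m + k + (k + 2) = 2 * m + (k + 1) + (k + 1)" by simp
  thus "real ((2 * m + k + (k + 2)) choose m) * (s / 2) ^ (2 * m + k + (k + 2)) /
      (fact (m + k) * fact (m + (k + 2)))
    \<le> real ((2 * m + (k + 1) + (k + 1)) choose m) * (s / 2) ^ (2 * m + (k + 1) + (k + 1)) /
      (fact (m + (k + 1)) * fact (m + (k + 1)))"
    using assms by (simp only:) (rule divide_left_mono[OF le]; simp)
qed

lemma bessel_I_Suc_le_poisson:
  assumes "0 < s"
  shows "real (k + 1) * bessel_I (k + 1) s \<le> s / 2 * bessel_I k s"
  using bessel_I_recurrence[of s k] bessel_I_pos[OF assms, of "k + 2"] assms by simp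

text \<open>With \<open>y = (k + 1) / s\<close> and \<open>\<rho>\<close> the ratio of orders \<open>k + 2\<close> and \<open>k + 1\<close>, the recurrence and
  log-concavity give \<open>\<rho>\<^sup>2 + 2 y \<rho> \<le> 1\<close>.  The value \<open>1 / (1 + y)\<close> lies above the positive
  root \<open>sqrt (1 + y\<^sup>2) - y\<close> of this quadratic, by a factor of at most \<open>2\<close>, and is easier to
  handle.\<close>

lemma bessel_I_Suc_le:
  assumes "0 < s"
  shows "(s + real (k + 1)) * bessel_I (k + 2) s \<le> s * bessel_I (k + 1) s"
proof -
  define y \<rho> where "y = real (k + 1) / s" and "\<rho> = bessel_I (k + 2) s / bessel_I (k + 1) s"
  note pos = bessel_I_pos[OF assms]
  have y: "0 < y" using assms by (simp add: y_def)
  have \<rho>: "0 < \<rho>" using pos by (simp add: \<rho>_def)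
  have "bessel_I k s = 2 * y * bessel_I (k + 1) s + bessel_I (k + 2) s"
    using bessel_I_recurrence[of s k] assms by (simp add: y_def field_simps)
  hence "(2 * y * bessel_I (k + 1) s + bessel_I (k + 2) s) * bessel_I (k + 2) s \<le> (bessel_I (k + 1) s)\<^sup>2"
    using bessel_I_log_concave[OF assms, of k] by simp
  moreover have "bessel_I (k + 2) s = \<rho> * bessel_I (k + 1) s"
    using pos[of "k + 1"] by (simp add: \<rho>_def)
  ultimately have "(2 * y * \<rho> + \<rho>\<^sup>2) * (bessel_I (k + 1) s)\<^sup>2 \<le> 1 * (bessel_I (k + 1) s)\<^sup>2"
    by (simp add: power2_eq_square algebra_simps)
  hence *: "2 * y * \<rho> + \<rho>\<^sup>2 \<le> 1"
    using pos[of "k + 1"] by (subst (asm) mult_le_cancel_right_pos) auto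
  have "\<rho> \<le> 1 / (1 + y)"
  proof (rule ccontr)
    assume "\<not> \<rho> \<le> 1 / (1 + y)"
    hence "2 * y * (1 / (1 + y)) + (1 / (1 + y))\<^sup>2 < 2 * y * \<rho> + \<rho>\<^sup>2"
      using y by (intro add_strict_mono mult_strict_left_mono power_strict_mono) auto
    moreover have "2 * y * (1 / (1 + y)) + (1 / (1 + y))\<^sup>2 = 1 + (y / (1 + y))\<^sup>2"
      using y by (simp add: divide_simps power2_eq_square) (simp add: algebra_simps)
    ultimately show False using * zero_le_power2[of "y / (1 + y)"] by linarith
  qed
  moreover have "1 / (1 + y) = s / (s + real (k + 1))"
    using assms by (simp add: y_def field_simps)
  ultimately show ?thesis
    using pos[of "k + 1"] assms by (simp add: \<rho>_def field_simps)
qed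

text \<open>Log-concavity used in the other direction: the ratio satisfies \<open>\<rho>\<^sup>2 + 2 z \<rho> \<ge> 1\<close> with
  \<open>z = (k + 1) / s\<close>, so it is at least the positive root \<open>exp (- arsinh z)\<close>, and \<open>arsinh z \<le> z\<close>.
  The last inequality appears below in the form \<open>exp z - z \<ge> sqrt (1 + z\<^sup>2)\<close>.\<close>

lemma bessel_I_Suc_ge:
  assumes "0 < s"
  shows "exp (- real (k + 1) / s) * bessel_I k s \<le> bessel_I (k + 1) s"
proof -
  define z \<rho> where "z = real (k + 1) / s" and "\<rho> = bessel_I (k + 1) s / bessel_I k s"
  note pos = bessel_I_pos[OF assms]
  have z: "0 < z" using assms by (simp add: z_def)
  have \<rho>: "0 < \<rho>" using pos by (simp add: \<rho>_def)
  have 1: "bessel_I (k + 1) s = \<rho> * bessel_I k s" using pos[of k] by (simp add: \<rho>_def)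
  have "bessel_I k s = 2 * z * bessel_I (k + 1) s + bessel_I (k + 2) s"
    using bessel_I_recurrence[of s k] assms by (simp add: z_def field_simps)
  hence "bessel_I k s * bessel_I k s =
      2 * z * bessel_I (k + 1) s * bessel_I k s + bessel_I k s * bessel_I (k + 2) s"
    by (metis distrib_left mult.commute)
  also have "\<dots> \<le> 2 * z * bessel_I (k + 1) s * bessel_I k s + (bessel_I (k + 1) s)\<^sup>2"
    using bessel_I_log_concave[OF assms, of k] by simp
  finally have "1 * (bessel_I k s)\<^sup>2 \<le> (2 * z * \<rho> + \<rho>\<^sup>2) * (bessel_I k s)\<^sup>2"
    unfolding 1 by (simp add: power2_eq_square algebra_simps)
  hence *: "1 \<le> 2 * z * \<rho> + \<rho>\<^sup>2"
    using pos[of k] by (subst (asm) mult_le_cancel_right_pos) auto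
  have "exp (- z) \<le> \<rho>"
  proof (rule ccontr)
    assume "\<not> exp (- z) \<le> \<rho>"
    hence "2 * z * \<rho> + \<rho>\<^sup>2 < 2 * z * exp (- z) + (exp (- z))\<^sup>2"
      using z \<rho> by (intro add_strict_mono mult_strict_left_mono power_strict_mono) auto
    with * have "1 < 2 * z * exp (- z) + (exp (- z))\<^sup>2" by linarith
    hence "(exp z)\<^sup>2 * 1 < (exp z)\<^sup>2 * (2 * z * exp (- z) + (exp (- z))\<^sup>2)"
      by (intro mult_strict_left_mono) auto
    also have "\<dots> = 2 * z * exp z + 1"
      by (simp add: exp_minus field_simps power2_eq_square)
    finally have "(exp z - z)\<^sup>2 < 1 + z\<^sup>2" by (simp add: power2_eq_square algebra_simps)
    moreover have "(1 + z\<^sup>2 / 2)\<^sup>2 \<le> (exp z - z)\<^sup>2"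
      using exp_lower_Taylor_quadratic[of z] z by (intro power_mono) auto
    moreover have "1 + z\<^sup>2 \<le> (1 + z\<^sup>2 / 2)\<^sup>2"
      using z by (simp add: power2_eq_square algebra_simps)
    ultimately show False by linarith
  qed
  hence "exp (- z) * bessel_I k s \<le> \<rho> * bessel_I k s" using pos[of k] by (intro mult_right_mono) auto
  thus ?thesis unfolding 1 by (simp only: z_def minus_divide_left)
qed

section \<open>Tails of the one-dimensional walk\<close>

text \<open>\<open>srw_mass s k\<close> and \<open>srw_tail s r\<close> will turn out to be the probabilities of \<open>X\<^sub>s = k\<close> and
  \<open>X\<^sub>s \<ge> r\<close>; the estimates need only their analytic expressions.\<close>

definition srw_mass :: "real \<Rightarrow> nat \<Rightarrow> real" where
  "srw_mass s k = exp (- s) * bessel_I k s"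

definition srw_tail :: "real \<Rightarrow> nat \<Rightarrow> real" where
  "srw_tail s r = (\<Sum>j. srw_mass s (r + j))"

context
  fixes s :: real
  assumes s_pos: "0 < s"
begin

lemma srw_mass_pos: "0 < srw_mass s k"
  by (simp add: srw_mass_def bessel_I_pos s_pos)

lemma srw_mass_Suc_le_poisson: "srw_mass s (Suc k) \<le> s / (2 * (real k + 1)) * srw_mass s k"
  using mult_left_mono[OF bessel_I_Suc_le_poisson[OF s_pos, of k], of "exp (- s)"]
  by (simp add: srw_mass_def field_simps)

lemma srw_mass_Suc_le:
  assumes "1 \<le> k"
  shows "srw_mass s (Suc k) \<le> s / (s + real k) * srw_mass s k"
proof -
  obtain l where k: "k = l + 1" using assms by (cases k) auto
  show ?thesis
    using mult_left_mono[OF bessel_I_Suc_le[OF s_pos, of l], of "exp (- s)"] s_pos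
    by (simp add: k srw_mass_def field_simps)
qed

text \<open>The product of \<open>j\<close> consecutive ratio bounds, each bounded below by the last one.\<close>

lemma srw_mass_add_ge: "exp (- real (j * (k + j)) / s) * srw_mass s k \<le> srw_mass s (k + j)"
proof (induction j)
  case (Suc j)
  have "exp (- real (Suc j * (k + Suc j)) / s) \<le> exp (- real (k + j + 1) / s) * exp (- real (j * (k + j)) / s)"
    using s_pos by (simp add: divide_simps flip: exp_add)
  hence "exp (- real (Suc j * (k + Suc j)) / s) * srw_mass s k
      \<le> exp (- real (k + j + 1) / s) * exp (- real (j * (k + j)) / s) * srw_mass s k"
    using srw_mass_pos[of k] by (intro mult_right_mono) auto
  also have "\<dots> \<le> exp (- real (k + j + 1) / s) * srw_mass s (k + j)"
    unfolding mult.assoc by (intro mult_left_mono Suc.IH) auto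
  also have "\<dots> \<le> srw_mass s (k + j + 1)"
    using mult_left_mono[OF bessel_I_Suc_ge[OF s_pos, of "k + j"], of "exp (- s)"]
    by (simp add: srw_mass_def algebra_simps)
  finally show ?case by simp
qed simp

lemma srw_mass_summable: "summable (\<lambda>j. srw_mass s (r + j))"
proof -
  have le: "srw_mass s k \<le> srw_mass s 0 * (inverse (fact k) * (s / 2) ^ k)" for k
  proof (induction k)
    case (Suc k)
    have "srw_mass s (Suc k) \<le> s / (2 * (real k + 1)) * srw_mass s k"
      by (rule srw_mass_Suc_le_poisson)
    also have "\<dots> \<le> s / (2 * (real k + 1)) * (srw_mass s 0 * (inverse (fact k) * (s / 2) ^ k))"
      using s_pos by (intro mult_left_mono Suc.IH) auto
    finally show ?case by (simp add: field_simps)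
  qed simp
  have "summable (\<lambda>k. srw_mass s k)"
  proof (rule summable_comparison_test)
    show "\<exists>N. \<forall>k\<ge>N. norm (srw_mass s k) \<le> srw_mass s 0 * (inverse (fact k) * (s / 2) ^ k)"
      using le less_imp_le[OF srw_mass_pos] by auto
    show "summable (\<lambda>k. srw_mass s 0 * (inverse (fact k) * (s / 2) ^ k))"
      by (intro summable_mult summable_exp)
  qed
  thus ?thesis by (subst add.commute) (rule summable_ignore_initial_segment)
qed

lemma srw_tail_Suc: "srw_tail s r = srw_mass s r + srw_tail s (Suc r)"
  using suminf_split_head[OF srw_mass_summable[of r]] by (simp add: srw_tail_def)

lemma srw_tail_split: "srw_tail s r = (\<Sum>j<n. srw_mass s (r + j)) + srw_tail s (r + n)"
proof (induction n)
  case (Suc n)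
  thus ?case using srw_tail_Suc[of "r + n"] by simp
qed simp

lemma srw_tail_pos: "0 < srw_tail s r"
  unfolding srw_tail_def by (intro suminf_pos srw_mass_summable srw_mass_pos)

text \<open>Since the ratio bounds decrease with the order, the first one holds all along the tail, and
  can be summed.\<close>

lemma srw_tail_Suc_le_ratio:
  assumes "\<And>j. srw_mass s (Suc (r + j)) \<le> c * srw_mass s (r + j)"
  shows "srw_tail s (Suc r) \<le> c * srw_tail s r"
proof -
  have "srw_tail s (Suc r) \<le> (\<Sum>j. c * srw_mass s (r + j))"
    unfolding srw_tail_def using srw_mass_summable[of "Suc r"] assms
    by (intro suminf_le summable_mult srw_mass_summable) auto
  thus ?thesis by (simp add: srw_tail_def suminf_mult srw_mass_summable)
qed

lemma srw_tail_Suc_le_poisson: "srw_tail s (Suc r) \<le> s / (2 * (real r + 1)) * srw_tail s r"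
proof (rule srw_tail_Suc_le_ratio)
  fix j
  have "s / (2 * (real (r + j) + 1)) \<le> s / (2 * (real r + 1))"
    using s_pos by (intro divide_left_mono) auto
  thus "srw_mass s (Suc (r + j)) \<le> s / (2 * (real r + 1)) * srw_mass s (r + j)"
    using srw_mass_Suc_le_poisson[of "r + j"] srw_mass_pos[of "r + j"]
    by (meson order_trans mult_right_mono less_imp_le)
qed

lemma srw_tail_Suc_le:
  assumes "1 \<le> r"
  shows "srw_tail s (Suc r) \<le> s / (s + real r) * srw_tail s r"
proof (rule srw_tail_Suc_le_ratio)
  fix j
  have "s / (s + real (r + j)) \<le> s / (s + real r)"
    using s_pos by (intro divide_left_mono) auto
  thus "srw_mass s (Suc (r + j)) \<le> s / (s + real r) * srw_mass s (r + j)"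
    using srw_mass_Suc_le[of "r + j"] srw_mass_pos[of "r + j"] assms
    by (meson order_trans mult_right_mono less_imp_le le_add1)
qed

text \<open>The geometric series in closed form: solve \<open>t\<^sub>r \<le> p\<^sub>r + s / (s + r) * t\<^sub>r\<close> for the tail
  \<open>t\<^sub>r\<close>.\<close>

lemma srw_tail_le_mass:
  assumes "1 \<le> r"
  shows "srw_tail s r \<le> (1 + s / real r) * srw_mass s r"
  using srw_tail_Suc_le[OF assms] srw_tail_Suc[of r] assms s_pos
  by (simp add: field_simps)

text \<open>The masses at distance up to \<open>n = \<lfloor>s / r\<rfloor>\<close> beyond \<open>r\<close> are comparable to the one at \<open>r\<close>:
  the exponent in \<open>srw_mass_add_ge\<close> is at most \<open>n (r + n) / s \<le> 2 n r / s \<le> 2\<close>, where \<open>n \<le> r\<close>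
  follows from \<open>s \<le> r\<^sup>2\<close>.\<close>

lemma srw_tail_ge_mass:
  assumes "1 \<le> r" "s \<le> (real r)\<^sup>2"
  shows "exp (- 2) * max (s / real r) 1 * srw_mass s r \<le> srw_tail s r"
proof -
  define n where "n = nat \<lfloor>s / real r\<rfloor>"
  have n_le: "real n \<le> s / real r" and n_gt: "s / real r < real n + 1"
    using s_pos by (auto simp: n_def)
  have r: "0 < real r" using assms by simp
  have "s / real r \<le> real r" using assms r by (simp add: field_simps power2_eq_square)
  hence n_r: "real n \<le> real r" using n_le by linarith
  have "exp (- 2) * srw_mass s r \<le> srw_mass s (r + j)" if "j < Suc n" for j
  proof -
    have "real (j * (r + j)) \<le> real n * (real r + real r)"
      using that n_r by (auto intro!: mult_mono)
    also have "\<dots> \<le> s / real r * (real r + real r)"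
      using n_le by (intro mult_right_mono) auto
    also have "\<dots> = 2 * s" using r by (simp add: field_simps)
    finally have "exp (- 2) \<le> exp (- real (j * (r + j)) / s)"
      using s_pos by (simp add: field_simps)
    thus ?thesis
      using srw_mass_add_ge[of j r] srw_mass_pos[of r]
      by (meson order_trans mult_right_mono less_imp_le)
  qed
  hence "(\<Sum>j<Suc n. exp (- 2) * srw_mass s r) \<le> (\<Sum>j<Suc n. srw_mass s (r + j))"
    by (intro sum_mono) simp
  also have "\<dots> \<le> srw_tail s r"
    using srw_tail_split[of r "Suc n"] srw_tail_pos[of "r + Suc n"] by linarith
  finally have "(real n + 1) * (exp (- 2) * srw_mass s r) \<le> srw_tail s r" by (simp add: algebra_simps)
  moreover have "max (s / real r) 1 * (exp (- 2) * srw_mass s r) \<le> (real n + 1) * (exp (- 2) * srw_mass s r)"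
    using n_gt srw_mass_pos[of r] by (intro mult_right_mono) auto
  ultimately show ?thesis by (simp add: mult_ac)
qed

text \<open>As long as \<open>i / s\<close> is bounded, \<open>s / (s + i) \<le> exp (- i / (4 s))\<close>.  The constant \<open>3\<close> is chosen
  to exceed \<open>exp 1\<close>, where the minimum and the logarithm in the rate function change form.  The
  product starts at order \<open>1\<close>, and the factor \<open>srw_tail s 1\<close> keeps \<open>r = 1\<close> nontrivial.\<close>

lemma srw_tail_le_gaussian:
  assumes "1 \<le> r" "real r \<le> 3 * s"
  shows "srw_tail s r \<le> exp (- real (r * (r - 1)) / (8 * s)) * srw_tail s 1"
  using assms
proof (induction r rule: dec_induct)
  case (step r)
  define y where "y = real r / (4 * s)"
  have y: "0 \<le> y" "y \<le> 1" using step s_pos by (auto simp: y_def field_simps)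
  have "exp y \<le> 1 + y + y\<^sup>2" by (rule exp_bound[OF y])
  also have "\<dots> \<le> 1 + y + y * 1" using y by (simp add: power2_eq_square mult_left_le)
  also have "\<dots> \<le> 1 + real r / s" using y by (simp add: y_def)
  finally have "exp y \<le> 1 + real r / s" .
  hence "s / (s + real r) \<le> exp (- y)"
    using s_pos by (simp add: exp_minus field_simps)
  hence "srw_tail s (Suc r) \<le> exp (- y) * srw_tail s r"
    using srw_tail_Suc_le[of r] step.hyps srw_tail_pos[of r]
    by (meson order_trans mult_right_mono less_imp_le)
  also have "\<dots> \<le> exp (- y) * (exp (- real (r * (r - 1)) / (8 * s)) * srw_tail s 1)"
    using step by (intro mult_left_mono step.IH) auto
  also have "\<dots> = exp (- real (Suc r * (Suc r - 1)) / (8 * s)) * srw_tail s 1"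
  proof -
    have "real r * real (r - 1) = real r * real r - real r"
      using step.hyps by (simp add: of_nat_diff algebra_simps)
    hence "- y + - real (r * (r - 1)) / (8 * s) = - real (Suc r * (Suc r - 1)) / (8 * s)"
      using s_pos by (simp add: y_def divide_simps)
    thus ?thesis by (simp only: mult.assoc[symmetric] exp_add[symmetric])
  qed
  finally show ?case .
qed simp

text \<open>Shifting the block \<open>[0, r)\<close> by \<open>r\<close> costs at most the factor \<open>exp (2 r\<^sup>2 / s)\<close>, and the
  shifted block lies in the tail.  This replaces a variance estimate for the walk.\<close>

lemma srw_tail_0_le: "srw_tail s 0 \<le> 2 * exp (2 * (real r)\<^sup>2 / s) * srw_tail s r"
proof -
  define E where "E = exp (2 * (real r)\<^sup>2 / s)"
  have "srw_mass s k \<le> E * srw_mass s (r + k)" if "k < r" for k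
  proof -
    have "real (r * (k + r)) \<le> real r * (real r + real r)"
      using that unfolding of_nat_mult by (intro mult_left_mono) auto
    hence "real (r * (k + r)) / s \<le> 2 * (real r)\<^sup>2 / s"
      using s_pos by (intro divide_right_mono) (auto simp: power2_eq_square)
    hence "1 \<le> E * exp (- real (r * (k + r)) / s)"
      by (simp add: E_def flip: exp_add)
    hence "1 * srw_mass s k \<le> E * exp (- real (r * (k + r)) / s) * srw_mass s k"
      using srw_mass_pos[of k] by (intro mult_right_mono) auto
    also have "\<dots> \<le> E * srw_mass s (r + k)"
      using srw_mass_add_ge[of r k] unfolding mult.assoc
      by (intro mult_left_mono) (auto simp: E_def add.commute)
    finally show ?thesis by simp
  qed
  hence "(\<Sum>k<r. srw_mass s k) \<le> (\<Sum>k<r. E * srw_mass s (r + k))"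
    by (intro sum_mono) simp
  also have "\<dots> \<le> E * srw_tail s r"
    using srw_tail_split[of r r] srw_tail_pos[of "r + r"]
    unfolding sum_distrib_left[symmetric] by (intro mult_left_mono) (auto simp: E_def)
  finally have "srw_tail s 0 \<le> E * srw_tail s r + 1 * srw_tail s r"
    using srw_tail_split[of 0 r] by simp
  also have "\<dots> \<le> E * srw_tail s r + E * srw_tail s r"
    using s_pos srw_tail_pos[of r] by (intro add_left_mono mult_right_mono) (auto simp: E_def)
  finally show ?thesis by (simp add: E_def mult_ac)
qed

lemma srw_tail_le_poisson: "srw_tail s r \<le> (s / 2) ^ r / fact r * srw_tail s 0"
proof (induction r)
  case (Suc r)
  have "srw_tail s (Suc r) \<le> s / (2 * (real r + 1)) * srw_tail s r"
    by (rule srw_tail_Suc_le_poisson)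
  also have "\<dots> \<le> s / (2 * (real r + 1)) * ((s / 2) ^ r / fact r * srw_tail s 0)"
    using s_pos by (intro mult_left_mono Suc.IH) auto
  finally show ?case by (simp add: field_simps)
qed simp

end

text \<open>The left-hand side is one term of the exponential series.\<close>

lemma power_div_fact_le_exp: "real n ^ n / fact n \<le> exp (real n)"
proof -
  have "inverse (fact n) * real n ^ n \<le> (\<Sum>k. inverse (fact k) * real n ^ k)"
    using sum_le_suminf[OF summable_exp[of "real n"], of "{n}"] by simp
  thus ?thesis by (simp add: exp_def divide_inverse mult.commute)
qed

text \<open>The bounds \<open>1 / 2\<close> on the tails at \<open>0\<close> and \<open>1\<close> are what symmetry of the walk provides; they are
  needed when \<open>r\<close> is close to \<open>sqrt s\<close>, where the rate function is of order one and the tail has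
  to stay away from \<open>0\<close> and from \<open>1\<close>.\<close>

lemma neg_ln_srw_tail_asymp:
  assumes s: "0 < s" and r: "1 \<le> r" "s \<le> (real r)\<^sup>2"
    and t0: "1 / 2 \<le> srw_tail s 0" "srw_tail s 0 \<le> 1" and t1: "srw_tail s 1 \<le> 1 / 2"
  defines "B \<equiv> real r * min (real r / s) 1 * ln (max (real r / s) (exp 1))"
  shows "1 / 16 * B \<le> - ln (srw_tail s r)" and "- ln (srw_tail s r) \<le> 4 * B"
proof -
  note t_pos = srw_tail_pos[OF s]
  have r0: "0 < real r" using r by simp
  have "(1::real) - ln 2 \<le> 1 / 2" "ln (2::real) \<le> 1"
    using ln_add_one_self_le_self[of "1::real"] ln2_ge_two_thirds by auto
  note ln2 = this ln2_ge_two_thirds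
  have e: "exp (1::real) \<le> 3" using exp_le by simp
  show "1 / 16 * B \<le> - ln (srw_tail s r)"
  proof (cases "real r / s \<le> exp 1")
    case True
    have "B = real r * min (real r / s) 1"
      using True by (simp add: B_def max_absorb2)
    moreover have "real r * min (real r / s) 1 \<le> real r * (real r / s)"
      "real r * min (real r / s) 1 \<le> real r * 1"
      using r0 by (intro mult_left_mono; simp)+
    ultimately have B: "B \<le> (real r)\<^sup>2 / s" "B \<le> real r" by (auto simp: power2_eq_square)
    have "real r \<le> 3 * s" proof -
      have "real r \<le> s * exp 1" using True s by (simp add: field_simps)
      also have "\<dots> \<le> s * 3" using e s by (intro mult_left_mono) auto
      finally show ?thesis by simp
    qed
    hence "srw_tail s r \<le> exp (- real (r * (r - 1)) / (8 * s)) * srw_tail s 1"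
      using srw_tail_le_gaussian[OF s r(1)] by simp
    also have "\<dots> \<le> exp (- real (r * (r - 1)) / (8 * s)) * (1 / 2)"
      by (intro mult_left_mono t1) auto
    finally have "ln (srw_tail s r) \<le> ln (exp (- real (r * (r - 1)) / (8 * s)) * (1 / 2))"
      using t_pos[of r] by (subst ln_le_cancel_iff) auto
    also have "\<dots> = - real (r * (r - 1)) / (8 * s) - ln 2" by (simp add: ln_mult ln_div)
    finally have *: "real (r * (r - 1)) / (8 * s) + ln 2 \<le> - ln (srw_tail s r)" by simp
    show ?thesis
    proof (cases "r = 1")
      case True
      thus ?thesis using * B ln2 by simp
    next
      case False
      hence "real r \<le> 2 * real (r - 1)" using r by linarith
      hence "real r * real r \<le> 2 * (real r * real (r - 1))" using r0 
        by (simp add: mult_left_mono mult.left_commute)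
      hence "1 / 16 * ((real r)\<^sup>2 / s) \<le> real (r * (r - 1)) / (8 * s)"
        using s by (simp add: field_simps power2_eq_square del: of_nat_diff)
      also have "\<dots> \<le> - ln (srw_tail s r)" using * ln2 by linarith
      finally have "1 / 16 * ((real r)\<^sup>2 / s) \<le> - ln (srw_tail s r)" .
      thus ?thesis by (rule order_trans[rotated]) (rule mult_left_mono[OF B(1)], simp)
    qed
  next
    case False
    \<comment> \<open>Now \<open>(s / 2)\<^sup>r / r! \<le> (exp 1 * s / (2 * r))\<^sup>r\<close>.  As \<open>r > exp 1 * s\<close>, the loss
      \<open>ln (exp 1 / 2)\<close> is at most a fixed fraction of the gain \<open>ln (r / s) \<ge> 1\<close>.\<close>
    define x where "x = ln (real r / s)"
    have ex: "exp x = real r / s" using s r0 by (simp add: x_def)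
    have x: "1 \<le> x" using False s r0 by (metis ex exp_le_cancel_iff linear)
    have "(1 :: real) < exp 1" by simp
    hence "1 < real r / s" using False by linarith
    hence B: "B = real r * x" using False by (simp add: B_def x_def max_absorb1 min_absorb2)
    have "srw_tail s r \<le> (s / 2) ^ r / fact r * srw_tail s 0"
      by (rule srw_tail_le_poisson[OF s])
    also have "\<dots> \<le> (s / 2) ^ r / fact r * 1"
      using s t0 by (intro mult_left_mono) auto
    also have "\<dots> = (s / (2 * real r)) ^ r * (real r ^ r / fact r)"
      using r0 by (simp add: power_divide power_mult_distrib field_simps)
    also have "\<dots> \<le> (s / (2 * real r)) ^ r * exp (real r)"
      using s r0 by (intro mult_left_mono power_div_fact_le_exp) auto
    finally have "ln (srw_tail s r) \<le> ln ((s / (2 * real r)) ^ r * exp (real r))"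
      using t_pos[of r] s r0 by (subst ln_le_cancel_iff) auto
    also have "\<dots> = real r * (1 - ln 2 - x)"
      using s r0 by (simp add: ln_mult ln_div ln_realpow x_def algebra_simps)
    also have "\<dots> \<le> real r * (- x / 16)"
      using ln2 x r0 by (intro mult_left_mono) auto
    finally show ?thesis by (simp add: B)
  qed
  show "- ln (srw_tail s r) \<le> 4 * B"
  proof (cases "real r \<le> s")
    case True
    hence le: "real r / s \<le> 1" using s by simp
    hence "max (real r / s) (exp 1) = exp 1" by (smt (verit) exp_ge_add_one_self)
    hence B: "B = (real r)\<^sup>2 / s" using le by (simp add: B_def min_def power2_eq_square)
    have B1: "1 \<le> B" using r s by (simp add: B)
    have "1 / 2 \<le> 2 * exp (2 * (real r)\<^sup>2 / s) * srw_tail s r"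
      using srw_tail_0_le[OF s, of r] t0 by linarith
    hence "ln (1 / 2) \<le> ln (2 * exp (2 * (real r)\<^sup>2 / s) * srw_tail s r)"
      using t_pos[of r] by (subst ln_le_cancel_iff) auto
    also have "\<dots> = ln 2 + 2 * B + ln (srw_tail s r)"
      using t_pos[of r] by (simp add: ln_mult B)
    finally have "- ln (srw_tail s r) \<le> 2 * B + 2 * ln 2" by (simp add: ln_div)
    thus ?thesis using B1 ln2 by linarith
  next
    case False
    define x where "x = ln (max (real r / s) (exp 1))"
    have x: "1 \<le> x" "ln (real r / s) \<le> x"
      using s r0 by (auto simp: x_def intro!: ln_mono) (smt (verit) ln_exp ln_mono exp_gt_zero)
    have B: "B = real r * x" using False s by (simp add: B_def x_def)
    have "(s / (2 * real r)) ^ r \<le> (s / 2) ^ r / fact r"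
    proof -
      have "(fact r :: real) \<le> real r ^ r" using fact_le_power[of r, where 'a = real] by simp
      hence "(s / 2) ^ r / real r ^ r \<le> (s / 2) ^ r / fact r"
        using s r0 by (intro divide_left_mono) auto
      thus ?thesis by (simp add: power_divide power_mult_distrib)
    qed
    hence "exp (- s) * (s / (2 * real r)) ^ r \<le> srw_mass s r"
      using bessel_I_ge_leading[OF s, of r] by (simp add: srw_mass_def)
    also have "\<dots> \<le> srw_tail s r" using srw_tail_Suc[OF s, of r] t_pos[of "Suc r"] by simp
    finally have "ln (exp (- s) * (s / (2 * real r)) ^ r) \<le> ln (srw_tail s r)"
      using t_pos[of r] s r0 by (subst ln_le_cancel_iff) auto
    moreover have "ln (exp (- s) * (s / (2 * real r)) ^ r) = - s - real r * ln 2 - real r * ln (real r / s)"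
      using s r0 by (simp add: ln_mult ln_div ln_realpow algebra_simps)
    moreover have "real r * ln 2 \<le> real r * x" "real r * ln (real r / s) \<le> real r * x" "real r * 1 \<le> real r * x"
      using x ln2 r0 by (intro mult_left_mono; simp)+
    moreover have "0 \<le> real r * x" using x by simp
    ultimately show ?thesis using False by (simp add: B)
  qed
qed

section \<open>The law of the walk\<close>

text \<open>The law of the position after \<open>n\<close> steps.  Being at \<open>k\<close> requires \<open>(n + k) / 2\<close> upward
  steps; for \<open>k > n\<close> the binomial coefficient vanishes by itself.\<close>

definition step_mass :: "nat \<Rightarrow> int \<Rightarrow> real" where
  "step_mass n k = (if even (int n + k) \<and> 0 \<le> int n + k
     then real (n choose nat ((int n + k) div 2)) / 2 ^ n else 0)"

lemma step_mass_0: "step_mass 0 k = (if k = 0 then 1 else 0)"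
  by (auto simp: step_mass_def elim!: evenE)

lemma step_mass_Suc: "step_mass (Suc n) k = (step_mass n (k - 1) + step_mass n (k + 1)) / 2"
proof (cases "even (int (Suc n) + k)")
  case True
  then obtain j where j: "int (Suc n) + k = 2 * j" by (elim evenE)
  hence k: "k = 2 * j - int n - 1" by simp
  show ?thesis
  proof (cases "j \<le> 0")
    case True
    thus ?thesis unfolding k by (cases "j = 0") (auto simp: step_mass_def)
  next
    case False
    then obtain i where i: "j = int (Suc i)" by (metis not_less gr0_implies_Suc zero_less_imp_eq_int)
    have "nat (1 + int i) = Suc i" by simp
    thus ?thesis unfolding k i by (simp add: step_mass_def add_divide_distrib)
  qed
next
  case False
  hence "odd (int n + (k - 1))" "odd (int n + (k + 1))" by auto
  thus ?thesis using False by (simp add: step_mass_def)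
qed

lemma step_mass_minus: "step_mass n (- k) = step_mass n k"
proof (cases "even (int n + k)")
  case True
  then obtain j where j: "int n + k = 2 * j" by (elim evenE)
  hence k: "k = 2 * j - int n" by simp
  consider "j < 0" | "int n < j" | "0 \<le> j" "j \<le> int n" by linarith
  thus ?thesis
  proof cases
    case 3
    then obtain i where i: "j = int i" "i \<le> n" by (metis nonneg_int_cases of_nat_le_iff)
    hence "nat (int n - j) = n - i" by simp
    moreover have "even (int n - k)" "(int n - k) div 2 = int n - j" using k by auto
    ultimately show ?thesis using j 3 i by (simp add: step_mass_def binomial_symmetric[OF i(2)])
  qed (auto simp: step_mass_def k binomial_eq_0)
next
  case False
  thus ?thesis by (simp add: step_mass_def)
qed

text \<open>Mixing the binomial laws over a Poisson number of steps: only \<open>n = 2 m + \<bar>k\<bar>\<close>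
  contributes, and the factorials of the Poisson weights cancel to leave the Bessel series.\<close>

lemma poisson_step_mass_sums:
  "(\<lambda>n. exp (- s) * s ^ n / fact n * step_mass n k) sums srw_mass s (nat \<bar>k\<bar>)"
proof -
  define l where "l = nat \<bar>k\<bar>"
  have "k = int l \<or> k = - int l" by (auto simp: l_def)
  hence sym: "step_mass n k = step_mass n (int l)" for n by (auto simp: step_mass_minus)
  let ?f = "\<lambda>n. exp (- s) * s ^ n / fact n * step_mass n (int l)"
  have "(\<lambda>m. ?f (2 * m + l)) sums srw_mass s l"
  proof -
    have "?f (2 * m + l) = exp (- s) * ((s / 2) ^ (2 * m + l) / (fact m * fact (m + l)))" for m
    proof -
      have "int (2 * m + l) + int l = 2 * int (m + l)" by simp
      hence "step_mass (2 * m + l) (int l) = real ((2 * m + l) choose (m + l)) / 2 ^ (2 * m + l)"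
        by (simp add: step_mass_def del: of_nat_add)
      also have "real ((2 * m + l) choose (m + l)) = fact (2 * m + l) / (fact (m + l) * fact m)"
        using binomial_fact[of "m + l" "2 * m + l", where 'a = real] by simp
      finally have *: "step_mass (2 * m + l) (int l) = fact (2 * m + l) / (fact (m + l) * fact m) / 2 ^ (2 * m + l)" .
      have "e * x / F * (F / (g * h) / y) = e * (x / y / (h * g))" if "F \<noteq> 0" for e x F g h y :: real
        using that by simp
      thus ?thesis unfolding * power_divide by simp
    qed
    moreover have "(\<lambda>m. exp (- s) * ((s / 2) ^ (2 * m + l) / (fact m * fact (m + l)))) sums srw_mass s l"
      unfolding srw_mass_def by (intro sums_mult bessel_I_sums)
    ultimately show ?thesis by simp
  qed
  moreover have "?f n = 0" if "n \<notin> range (\<lambda>m. 2 * m + l)" for n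
  proof (cases "even (int n + int l)")
    case True
    then obtain j where j: "int n + int l = 2 * j" by (elim evenE)
    have "n < l"
    proof (rule ccontr)
      assume "\<not> n < l"
      hence "n = 2 * nat (j - int l) + l" using j by linarith
      thus False using that by blast
    qed
    hence "n < nat j" using j by linarith
    thus ?thesis using j by (simp add: step_mass_def binomial_eq_0)
  qed (simp add: step_mass_def)
  moreover have "strict_mono (\<lambda>m. 2 * m + l)" by (simp add: strict_mono_def)
  ultimately have "?f sums srw_mass s l" by (subst (asm) sums_mono_reindex) auto
  thus ?thesis by (simp add: sym l_def)
qed

lemma jump_count_eq:
  assumes nonneg: "\<And>i. 0 \<le> \<tau> i \<omega>"
    and le: "(\<Sum>i<n. \<tau> i \<omega>) \<le> s" and gt: "s < (\<Sum>i<Suc n. \<tau> i \<omega>)"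
  shows "jump_count \<tau> s \<omega> = n"
proof -
  have mono: "(\<Sum>i<m. \<tau> i \<omega>) \<le> (\<Sum>i<m'. \<tau> i \<omega>)" if "m \<le> m'" for m m'
    using that nonneg by (intro sum_mono2) auto
  have "(\<Sum>i\<le>m. \<tau> i \<omega>) \<le> s \<longleftrightarrow> m < n" for m
  proof
    assume "m < n"
    thus "(\<Sum>i\<le>m. \<tau> i \<omega>) \<le> s" using mono[of "Suc m" n] le by (simp add: lessThan_Suc_atMost)
  next
    assume "(\<Sum>i\<le>m. \<tau> i \<omega>) \<le> s"
    thus "m < n" using mono[of "Suc n" "Suc m"] gt by (force simp: lessThan_Suc_atMost not_less)
  qed
  hence "{m. (\<Sum>i\<le>m. \<tau> i \<omega>) \<le> s} = {..<n}" by auto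
  thus ?thesis by (simp add: jump_count_def)
qed

locale srw_construction = prob_space M for M :: "'a measure" +
  fixes \<tau> :: "nat \<Rightarrow> 'a \<Rightarrow> real" and \<xi> :: "nat \<Rightarrow> 'a \<Rightarrow> int"
  assumes indep: "indep_vars (\<lambda>_. borel) (case_sum \<tau> (\<lambda>n \<omega>. real_of_int (\<xi> n \<omega>))) (UNIV :: (nat + nat) set)"
    and waiting: "distributed M lborel (\<tau> n) (exponential_density 1)"
    and step_up: "\<P>(\<omega> in M. \<xi> n \<omega> = 1) = 1 / 2"
    and step_down: "\<P>(\<omega> in M. \<xi> n \<omega> = - 1) = 1 / 2"
begin

abbreviation Z :: "nat + nat \<Rightarrow> 'a \<Rightarrow> real" where
  "Z \<equiv> case_sum \<tau> (\<lambda>n \<omega>. real_of_int (\<xi> n \<omega>))"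

text \<open>Counted so that \<open>arrival 0 = 0\<close>: the jump with index \<open>n\<close> occurs at time
  \<open>arrival (Suc n)\<close>.\<close>

definition arrival :: "nat \<Rightarrow> 'a \<Rightarrow> real" where
  "arrival n \<omega> = (\<Sum>i<n. \<tau> i \<omega>)"

definition position :: "nat \<Rightarrow> 'a \<Rightarrow> int" where
  "position n \<omega> = (\<Sum>i<n. \<xi> i \<omega>)"

lemma measurable_Z: "Z i \<in> borel_measurable M"
  using indep by (auto simp: indep_vars_def)

lemma measurable_waiting [measurable]: "\<tau> n \<in> borel_measurable M"
  using measurable_Z[of "Inl n"] by simp

lemma measurable_step [measurable]: "\<xi> n \<in> measurable M (count_space UNIV)"
proof -
  have [measurable]: "(\<lambda>\<omega>. real_of_int (\<xi> n \<omega>)) \<in> borel_measurable M"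
    using measurable_Z[of "Inr n"] by simp
  have "(\<lambda>\<omega>. \<lfloor>real_of_int (\<xi> n \<omega>)\<rfloor>) \<in> measurable M (count_space UNIV)" by measurable
  thus ?thesis by simp
qed

lemma measurable_arrival [measurable]: "arrival n \<in> borel_measurable M"
  unfolding arrival_def[abs_def] by measurable

lemma measurable_position [measurable]: "position n \<in> measurable M (count_space UNIV)"
proof -
  have "(\<lambda>\<omega>. \<lfloor>\<Sum>i<n. Z (Inr i) \<omega>\<rfloor>) \<in> measurable M (count_space UNIV)"
    using measurable_Z by measurable
  moreover have "(\<lambda>\<omega>. \<lfloor>\<Sum>i<n. Z (Inr i) \<omega>\<rfloor>) = position n"
    unfolding position_def by (rule ext) (simp flip: of_int_sum)
  ultimately show ?thesis by (simp only:)
qed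

lemma AE_step: "AE \<omega> in M. \<xi> n \<omega> = 1 \<or> \<xi> n \<omega> = - 1"
proof -
  have "\<P>(\<omega> in M. \<xi> n \<omega> = 1 \<or> \<xi> n \<omega> = - 1) =
      measure M ({\<omega> \<in> space M. \<xi> n \<omega> = 1} \<union> {\<omega> \<in> space M. \<xi> n \<omega> = - 1})"
    by (rule arg_cong[where f = "measure M"]) auto
  also have "\<dots> = \<P>(\<omega> in M. \<xi> n \<omega> = 1) + \<P>(\<omega> in M. \<xi> n \<omega> = - 1)"
    by (rule finite_measure_Union) auto
  finally show ?thesis
    using step_up[of n] step_down[of n] by (subst prob_Collect_eq_1[symmetric]) auto
qed

lemma prob_position: "\<P>(\<omega> in M. position n \<omega> = k) = step_mass n k"
proof (induction n arbitrary: k)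
  case 0
  show ?case by (cases "k = 0") (auto simp: position_def step_mass_0 prob_space)
next
  case (Suc n)
  have ind: "indep_var borel (Z (Inr n)) borel (\<lambda>\<omega>. \<Sum>i\<in>Inr ` {..<n}. Z i \<omega>)"
    by (intro indep_vars_sum indep_vars_subset[OF indep]) auto
  have prod: "\<P>(\<omega> in M. \<xi> n \<omega> = e \<and> position n \<omega> = l) =
      \<P>(\<omega> in M. \<xi> n \<omega> = e) * \<P>(\<omega> in M. position n \<omega> = l)" for e l
  proof -
    have "(\<Sum>i\<in>Inr ` {..<n}. Z i \<omega>) = real_of_int (position n \<omega>)" for \<omega>
      by (simp add: sum.reindex position_def)
    thus ?thesis
      using prob_indep_random_variable[OF ind, of "{real_of_int e}" "{real_of_int l}"] by simp
  qed
  have "\<P>(\<omega> in M. position (Suc n) \<omega> = k) =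
      measure M ({\<omega> \<in> space M. \<xi> n \<omega> = 1 \<and> position n \<omega> = k - 1} \<union>
                 {\<omega> \<in> space M. \<xi> n \<omega> = - 1 \<and> position n \<omega> = k + 1})"
  proof (rule finite_measure_eq_AE)
    show "AE \<omega> in M. \<omega> \<in> {\<omega> \<in> space M. position (Suc n) \<omega> = k} \<longleftrightarrow>
        \<omega> \<in> {\<omega> \<in> space M. \<xi> n \<omega> = 1 \<and> position n \<omega> = k - 1} \<union>
            {\<omega> \<in> space M. \<xi> n \<omega> = - 1 \<and> position n \<omega> = k + 1}"
      using AE_step[of n] by eventually_elim (auto simp: position_def)
  qed measurable
  also have "\<dots> = \<P>(\<omega> in M. \<xi> n \<omega> = 1 \<and> position n \<omega> = k - 1) +
      \<P>(\<omega> in M. \<xi> n \<omega> = - 1 \<and> position n \<omega> = k + 1)"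
    by (rule finite_measure_Union) auto
  finally show ?case
    by (simp only: prod step_up step_down Suc.IH step_mass_Suc) simp
qed

lemma AE_waiting_nonneg: "AE \<omega> in M. \<forall>n. 0 \<le> \<tau> n \<omega>"
proof (subst AE_all_countable, rule allI)
  fix n
  have "\<P>(\<omega> in M. 0 < \<tau> n \<omega>) = 1"
    using exponential_distributedD_gt[OF waiting, of 0 n] by simp
  hence "AE \<omega> in M. 0 < \<tau> n \<omega>" by (subst (asm) prob_Collect_eq_1) auto
  thus "AE \<omega> in M. 0 \<le> \<tau> n \<omega>" by eventually_elim simp
qed

lemma prob_arrival_le:
  assumes "0 \<le> s"
  shows "\<P>(\<omega> in M. arrival n \<omega> \<le> s) = 1 - (\<Sum>j<n. exp (- s) * s ^ j / fact j)"
proof (cases n)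
  case 0
  thus ?thesis using assms by (simp add: arrival_def prob_space)
next
  case (Suc m)
  let ?I = "Inl ` {..<n} :: (nat + nat) set"
  have "distributed M lborel (\<lambda>\<omega>. \<Sum>i\<in>?I. Z i \<omega>) (erlang_density (card ?I - 1) 1)"
    using Suc waiting by (intro exponential_distributed_sum indep_vars_subset[OF indep]) auto
  hence "distributed M lborel (arrival n) (erlang_density m 1)"
    by (simp add: sum.reindex card_image Suc arrival_def[abs_def])
  hence "\<P>(\<omega> in M. arrival n \<omega> \<le> s) = erlang_CDF m 1 s"
    using assms by (intro erlang_distributed_le) auto
  also have "\<dots> = 1 - (\<Sum>j<n. exp (- s) * s ^ j / fact j)"
    using assms by (simp add: erlang_CDF_def Suc lessThan_Suc_atMost mult.commute)
  finally show ?thesis .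
qed

text \<open>The condition on all earlier arrivals makes the events for different \<open>n\<close> disjoint
  everywhere, including where some waiting time is negative.\<close>

definition jumps :: "real \<Rightarrow> nat \<Rightarrow> 'a \<Rightarrow> bool" where
  "jumps s n \<omega> \<longleftrightarrow> (\<forall>m\<le>n. arrival m \<omega> \<le> s) \<and> s < arrival (Suc n) \<omega>"

lemma measurable_jumps [measurable]: "Measurable.pred M (jumps s n)"
  unfolding jumps_def[abs_def] by measurable

lemma jumps_unique: "jumps s n \<omega> \<Longrightarrow> jumps s m \<omega> \<Longrightarrow> n = m"
  by (metis jumps_def not_less not_less_eq_eq linorder_neqE_nat Suc_leI leD)

lemma prob_jumps:
  assumes "0 \<le> s"
  shows "\<P>(\<omega> in M. jumps s n \<omega>) = exp (- s) * s ^ n / fact n"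
proof -
  have mono: "AE \<omega> in M. \<forall>i j. i \<le> j \<longrightarrow> arrival i \<omega> \<le> arrival j \<omega>"
    using AE_waiting_nonneg by eventually_elim (auto simp: arrival_def intro!: sum_mono2)
  have "\<P>(\<omega> in M. jumps s n \<omega>) =
      measure M ({\<omega> \<in> space M. arrival n \<omega> \<le> s} - {\<omega> \<in> space M. arrival n \<omega> \<le> s \<and> arrival (Suc n) \<omega> \<le> s})"
  proof (rule finite_measure_eq_AE)
    show "AE \<omega> in M. \<omega> \<in> {\<omega> \<in> space M. jumps s n \<omega>} \<longleftrightarrow> \<omega> \<in> {\<omega> \<in> space M. arrival n \<omega> \<le> s} -
        {\<omega> \<in> space M. arrival n \<omega> \<le> s \<and> arrival (Suc n) \<omega> \<le> s}"
      using mono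
    proof eventually_elim
      case (elim \<omega>)
      hence "(\<forall>m\<le>n. arrival m \<omega> \<le> s) \<longleftrightarrow> arrival n \<omega> \<le> s"
        by (meson order_refl order_trans)
      thus ?case by (auto simp: jumps_def)
    qed
  qed measurable
  also have "\<dots> = \<P>(\<omega> in M. arrival n \<omega> \<le> s) - \<P>(\<omega> in M. arrival n \<omega> \<le> s \<and> arrival (Suc n) \<omega> \<le> s)"
    by (rule finite_measure_Diff) auto
  also have "\<P>(\<omega> in M. arrival n \<omega> \<le> s \<and> arrival (Suc n) \<omega> \<le> s) = \<P>(\<omega> in M. arrival (Suc n) \<omega> \<le> s)"
  proof (rule finite_measure_eq_AE)
    show "AE \<omega> in M. \<omega> \<in> {\<omega> \<in> space M. arrival n \<omega> \<le> s \<and> arrival (Suc n) \<omega> \<le> s} \<longleftrightarrow>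
        \<omega> \<in> {\<omega> \<in> space M. arrival (Suc n) \<omega> \<le> s}"
      using mono
    proof eventually_elim
      case (elim \<omega>)
      hence "arrival n \<omega> \<le> arrival (Suc n) \<omega>" by simp
      thus ?case by auto
    qed
  qed measurable
  finally show ?thesis by (simp add: prob_arrival_le[OF assms])
qed

text \<open>The Poisson weights sum to \<open>1\<close>, which excludes both explosion and the junk value of
  \<open>jump_count\<close>.\<close>

lemma AE_jumps:
  assumes "0 \<le> s"
  shows "AE \<omega> in M. \<exists>n. jumps s n \<omega>"
proof -
  have "(\<lambda>n. \<P>(\<omega> in M. jumps s n \<omega>)) sums measure M (\<Union>n. {\<omega> \<in> space M. jumps s n \<omega>})"
    by (rule finite_measure_UNION) (auto simp: disjoint_family_on_def dest: jumps_unique)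
  moreover have "(\<lambda>n. \<P>(\<omega> in M. jumps s n \<omega>)) sums (exp (- s) * exp s)"
    using sums_mult[OF exp_converges[of s], of "exp (- s)"]
    by (simp add: prob_jumps[OF assms] divide_inverse mult_ac)
  ultimately have "measure M (\<Union>n. {\<omega> \<in> space M. jumps s n \<omega>}) = 1"
    using sums_unique2 by (fastforce simp flip: exp_add)
  moreover have "(\<Union>n. {\<omega> \<in> space M. jumps s n \<omega>}) = {\<omega> \<in> space M. \<exists>n. jumps s n \<omega>}" by auto
  ultimately have "\<P>(\<omega> in M. \<exists>n. jumps s n \<omega>) = 1" by simp
  thus ?thesis by (subst (asm) prob_Collect_eq_1) auto
qed

text \<open>The first event is a function of all waiting times, the second of all steps, and these two
  subfamilies of the independent family are independent.\<close>

lemma prob_jumps_position: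
  "\<P>(\<omega> in M. jumps s n \<omega> \<and> position n \<omega> = k) = \<P>(\<omega> in M. jumps s n \<omega>) * \<P>(\<omega> in M. position n \<omega> = k)"
proof -
  let ?P = "\<lambda>A. PiM A (\<lambda>_. borel :: real measure)"
  let ?L = "range Inl :: (nat + nat) set" and ?R = "range Inr :: (nat + nat) set"
  let ?Q = "\<lambda>A \<omega>. restrict (\<lambda>i. Z i \<omega>) A"
  define U where "U = {f \<in> space (?P ?L). (\<forall>m\<le>n. (\<Sum>i<m. f (Inl i)) \<le> s) \<and> s < (\<Sum>i<Suc n. f (Inl i))}"
  define V where "V = {f \<in> space (?P ?R). (\<Sum>i<n. f (Inr i)) = real_of_int k}"
  have [measurable]: "(\<lambda>f. f (Inl i)) \<in> borel_measurable (?P ?L)" for i :: nat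
    by (rule measurable_component_singleton) simp
  have [measurable]: "(\<lambda>f. f (Inr i)) \<in> borel_measurable (?P ?R)" for i :: nat
    by (rule measurable_component_singleton) simp
  have "indep_var (?P ?L) (?Q ?L) (?P ?R) (?Q ?R)"
    by (rule indep_var_restrict[OF indep]) auto
  moreover have "U \<in> sets (?P ?L)" unfolding U_def by measurable
  moreover have "V \<in> sets (?P ?R)" unfolding V_def by measurable
  ultimately have "prob ((\<lambda>\<omega>. (?Q ?L \<omega>, ?Q ?R \<omega>)) -` (U \<times> V) \<inter> space M) =
      prob (?Q ?L -` U \<inter> space M) * prob (?Q ?R -` V \<inter> space M)"
    by (rule indep_varD)
  moreover have RU: "?Q ?L \<omega> \<in> U \<longleftrightarrow> jumps s n \<omega>" for \<omega>
    by (auto simp: U_def jumps_def arrival_def space_PiM)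
  moreover have RV: "?Q ?R \<omega> \<in> V \<longleftrightarrow> position n \<omega> = k" for \<omega>
    by (simp add: V_def position_def space_PiM flip: of_int_sum)
  moreover have "(\<lambda>\<omega>. (?Q ?L \<omega>, ?Q ?R \<omega>)) -` (U \<times> V) \<inter> space M =
      {\<omega> \<in> space M. jumps s n \<omega> \<and> position n \<omega> = k}"
    using RU RV by blast
  moreover have "?Q ?L -` U \<inter> space M = {\<omega> \<in> space M. jumps s n \<omega>}" using RU by blast
  moreover have "?Q ?R -` V \<inter> space M = {\<omega> \<in> space M. position n \<omega> = k}" using RV by blast
  ultimately show ?thesis by simp
qed

lemma prob_walk_eq:
  assumes "0 \<le> s" and X [measurable]: "Y \<in> measurable M (count_space UNIV)"
    and Y: "AE \<omega> in M. Y \<omega> = (\<Sum>i<jump_count \<tau> s \<omega>. \<xi> i \<omega>)"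
  shows "\<P>(\<omega> in M. Y \<omega> = k) = srw_mass s (nat \<bar>k\<bar>)"
proof -
  have "\<P>(\<omega> in M. Y \<omega> = k) = measure M (\<Union>n. {\<omega> \<in> space M. jumps s n \<omega> \<and> position n \<omega> = k})"
  proof (rule finite_measure_eq_AE)
    show "AE \<omega> in M. \<omega> \<in> {\<omega> \<in> space M. Y \<omega> = k} \<longleftrightarrow>
        \<omega> \<in> (\<Union>n. {\<omega> \<in> space M. jumps s n \<omega> \<and> position n \<omega> = k})"
      using Y AE_waiting_nonneg AE_jumps[OF assms(1)]
    proof eventually_elim
      case (elim \<omega>)
      then obtain n where n: "jumps s n \<omega>" by blast
      hence "jump_count \<tau> s \<omega> = n"
        using elim by (intro jump_count_eq) (auto simp: jumps_def arrival_def)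
      hence "Y \<omega> = position n \<omega>" using elim by (simp add: position_def)
      moreover have "jumps s m \<omega> \<longleftrightarrow> m = n" for m using n jumps_unique by blast
      ultimately show ?case by auto
    qed
  qed measurable
  moreover have "(\<lambda>n. \<P>(\<omega> in M. jumps s n \<omega> \<and> position n \<omega> = k)) sums
      measure M (\<Union>n. {\<omega> \<in> space M. jumps s n \<omega> \<and> position n \<omega> = k})"
    by (rule finite_measure_UNION) (auto simp: disjoint_family_on_def dest: jumps_unique)
  moreover have "(\<lambda>n. \<P>(\<omega> in M. jumps s n \<omega> \<and> position n \<omega> = k)) sums srw_mass s (nat \<bar>k\<bar>)"
    using poisson_step_mass_sums[of s k]
    by (simp add: prob_jumps_position prob_jumps[OF assms(1)] prob_position)
  ultimately show ?thesis by (simp only: sums_unique2[of _ _ "srw_mass s (nat \<bar>k\<bar>)"])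
qed

end

lemma rate_one_srw_point_prob:
  assumes "rate_one_srw M 0 X" "0 \<le> s"
  shows "\<P>(\<omega> in M. X s \<omega> = k) = srw_mass s (nat \<bar>k\<bar>)"
proof -
  from assms obtain \<tau> \<xi> where
    "prob_space M" and X: "X s \<in> measurable M (count_space UNIV)" and
    "prob_space.indep_vars M (\<lambda>_. borel) (case_sum \<tau> (\<lambda>n \<omega>. real_of_int (\<xi> n \<omega>))) (UNIV :: (nat + nat) set)"
    "\<And>n. distributed M lborel (\<tau> n) (exponential_density 1)"
    "\<And>n. \<P>(\<omega> in M. \<xi> n \<omega> = 1) = 1 / 2" "\<And>n. \<P>(\<omega> in M. \<xi> n \<omega> = - 1) = 1 / 2" and
    ae: "AE \<omega> in M. \<forall>s\<ge>0. X s \<omega> = 0 + (\<Sum>i<jump_count \<tau> s \<omega>. \<xi> i \<omega>)"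
    unfolding rate_one_srw_def by blast
  then interpret srw_construction M \<tau> \<xi>
    by (auto simp: srw_construction_def srw_construction_axioms_def)
  have "AE \<omega> in M. X s \<omega> = (\<Sum>i<jump_count \<tau> s \<omega>. \<xi> i \<omega>)"
    using ae assms(2) by (auto elim: eventually_mono)
  thus ?thesis using prob_walk_eq assms(2) X by blast
qed

lemma rate_one_srw_tail_prob:
  assumes walk: "rate_one_srw M 0 X" and s: "0 \<le> s"
  shows "\<P>(\<omega> in M. int r \<le> X s \<omega>) = srw_tail s r" "\<P>(\<omega> in M. X s \<omega> \<le> - int r) = srw_tail s r"
proof -
  interpret prob_space M using walk by (simp add: rate_one_srw_def)
  have [measurable]: "X s \<in> measurable M (count_space UNIV)"
    using walk s by (simp add: rate_one_srw_def)
  have *: "measure M (\<Union>j. {\<omega> \<in> space M. X s \<omega> = e * int (r + j)}) = srw_tail s r" if "e = 1 \<or> e = - 1" for e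
  proof -
    have "(\<lambda>j. \<P>(\<omega> in M. X s \<omega> = e * int (r + j))) sums measure M (\<Union>j. {\<omega> \<in> space M. X s \<omega> = e * int (r + j)})"
      using that by (intro finite_measure_UNION) (auto simp: disjoint_family_on_def)
    moreover have "\<P>(\<omega> in M. X s \<omega> = e * int (r + j)) = srw_mass s (r + j)" for j
      using that by (subst rate_one_srw_point_prob[OF walk s]) (auto simp del: of_nat_add)
    ultimately show ?thesis by (simp add: srw_tail_def sums_iff)
  qed
  have "int r \<le> l \<longleftrightarrow> (\<exists>j. l = 1 * int (r + j))" for l
    by (auto intro!: exI[of _ "nat (l - int r)"])
  hence "{\<omega> \<in> space M. int r \<le> X s \<omega>} = (\<Union>j. {\<omega> \<in> space M. X s \<omega> = 1 * int (r + j)})"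
    by blast
  thus "\<P>(\<omega> in M. int r \<le> X s \<omega>) = srw_tail s r" using *[of 1] by simp
  have "l \<le> - int r \<longleftrightarrow> (\<exists>j. l = - 1 * int (r + j))" for l
    by (auto intro!: exI[of _ "nat (- l - int r)"])
  hence "{\<omega> \<in> space M. X s \<omega> \<le> - int r} = (\<Union>j. {\<omega> \<in> space M. X s \<omega> = - 1 * int (r + j)})"
    by blast
  thus "\<P>(\<omega> in M. X s \<omega> \<le> - int r) = srw_tail s r" using *[of "- 1"] by simp
qed

text \<open>The half-lines \<open>X\<^sub>s \<ge> 0\<close> and \<open>X\<^sub>s \<le> 0\<close> cover everything, while \<open>X\<^sub>s \<ge> 1\<close> and \<open>X\<^sub>s \<le> - 1\<close>
  are disjoint; by symmetry the two members of each pair are equally likely.\<close>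

lemma rate_one_srw_tail_bounds:
  assumes walk: "rate_one_srw M 0 X" and s: "0 \<le> s"
  shows "1 / 2 \<le> srw_tail s 0" "srw_tail s 0 \<le> 1" "srw_tail s 1 \<le> 1 / 2"
proof -
  interpret prob_space M using walk by (simp add: rate_one_srw_def)
  have [measurable]: "X s \<in> measurable M (count_space UNIV)"
    using walk s by (simp add: rate_one_srw_def)
  note tail = rate_one_srw_tail_prob[OF walk s]
  have "1 = measure M ({\<omega> \<in> space M. int 0 \<le> X s \<omega>} \<union> {\<omega> \<in> space M. X s \<omega> \<le> - int 0})"
    by (subst prob_space[symmetric]) (rule arg_cong[where f = "measure M"], auto)
  also have "\<dots> \<le> \<P>(\<omega> in M. int 0 \<le> X s \<omega>) + \<P>(\<omega> in M. X s \<omega> \<le> - int 0)"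
    by (rule measure_Un_le) auto
  finally show "1 / 2 \<le> srw_tail s 0" unfolding tail by simp
  show "srw_tail s 0 \<le> 1" unfolding tail(1)[of 0, symmetric] by (rule prob_le_1)
  have "\<P>(\<omega> in M. int 1 \<le> X s \<omega>) + \<P>(\<omega> in M. X s \<omega> \<le> - int 1) =
      measure M ({\<omega> \<in> space M. int 1 \<le> X s \<omega>} \<union> {\<omega> \<in> space M. X s \<omega> \<le> - int 1})"
    by (rule finite_measure_Union[symmetric]) auto
  also have "\<dots> \<le> 1" by (rule prob_le_1)
  finally show "srw_tail s 1 \<le> 1 / 2" unfolding tail by simp
qed

lemma srw_tail_paramsE:
  assumes "(M, X, s, r) \<in> srw_tail_params"
  obtains n where "r = int n" "1 \<le> n" "0 < s" "s \<le> (real n)\<^sup>2" "rate_one_srw M 0 X"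
proof -
  have s: "0 < s" "sqrt s \<le> real_of_int r" and walk: "rate_one_srw M 0 X"
    using assms by (auto simp: srw_tail_params_def)
  hence "0 < real_of_int r" by (meson less_le_trans real_sqrt_gt_zero)
  hence "0 < r" by simp
  then obtain n where n: "r = int n" by (meson less_imp_le nonneg_int_cases)
  have "s \<le> (real n)\<^sup>2" using s by (simp add: n sqrt_le_D)
  thus ?thesis using that n \<open>0 < r\<close> s walk by simp
qed

lemma asymp_on_tupleI:
  assumes "0 < c" "c \<le> C"
    and "\<And>x y z w. (x, y, z, w) \<in> P \<Longrightarrow> c * b x y z w \<le> a x y z w \<and> a x y z w \<le> C * b x y z w"
  shows "asymp_on P (\<lambda>(x, y, z, w). a x y z w) (\<lambda>(x, y, z, w). b x y z w)"
  unfolding asymp_on_def using assms by (intro exI[of _ c] exI[of _ C]) auto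

theorem propositionC6:
  shows "asymp_on (srw_tail_params :: ('a measure \<times> (real \<Rightarrow> 'a \<Rightarrow> int) \<times> real \<times> int) set)
      (\<lambda>(M, X, s, r). - ln (\<P>(\<omega> in M. r \<le> X s \<omega>)))
      (\<lambda>(M, X, s, r). real_of_int r * min (real_of_int r / s) 1
                        * ln (max (real_of_int r / s) (exp 1)))
    \<and> asymp_on (srw_tail_params :: ('a measure \<times> (real \<Rightarrow> 'a \<Rightarrow> int) \<times> real \<times> int) set)
      (\<lambda>(M, X, s, r). \<P>(\<omega> in M. r \<le> X s \<omega>) / \<P>(\<omega> in M. X s \<omega> = r))
      (\<lambda>(M, X, s, r). max (s / real_of_int r) 1)"
proof (rule conjI, goal_cases)
  case 1
  show ?case
  proof (rule asymp_on_tupleI[of "1 / 16" 4])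
    fix M :: "'a measure" and X s r
    assume "(M, X, s, r) \<in> srw_tail_params"
    then obtain n where n: "r = int n" "1 \<le> n" "0 < s" "s \<le> (real n)\<^sup>2" "rate_one_srw M 0 X"
      by (rule srw_tail_paramsE)
    have s: "0 \<le> s" using n by simp
    note bounds = neg_ln_srw_tail_asymp[OF n(3,2,4) rate_one_srw_tail_bounds[OF n(5) s]]
    have tail: "\<P>(\<omega> in M. r \<le> X s \<omega>) = srw_tail s n"
      using rate_one_srw_tail_prob(1)[OF n(5) s, of n] by (simp add: n(1))
    show "1 / 16 * (real_of_int r * min (real_of_int r / s) 1 * ln (max (real_of_int r / s) (exp 1)))
          \<le> - ln (\<P>(\<omega> in M. r \<le> X s \<omega>)) \<and>
        - ln (\<P>(\<omega> in M. r \<le> X s \<omega>)) \<le>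
          4 * (real_of_int r * min (real_of_int r / s) 1 * ln (max (real_of_int r / s) (exp 1)))"
      using bounds unfolding tail by (simp only: n(1) of_int_of_nat_eq simp_thms)
  qed auto
next
  case 2
  show ?case
  proof (rule asymp_on_tupleI[of "exp (- 2)" 2])
    show "exp (- 2 :: real) \<le> 2" by (rule order_trans[of _ "exp 0"]) simp_all
  next
    fix M :: "'a measure" and X s r
    assume "(M, X, s, r) \<in> srw_tail_params"
    then obtain n where n: "r = int n" "1 \<le> n" "0 < s" "s \<le> (real n)\<^sup>2" "rate_one_srw M 0 X"
      by (rule srw_tail_paramsE)
    have s: "0 \<le> s" using n by simp
    have tail: "\<P>(\<omega> in M. r \<le> X s \<omega>) = srw_tail s n"
      using rate_one_srw_tail_prob(1)[OF n(5) s, of n] by (simp add: n(1))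
    have point: "\<P>(\<omega> in M. X s \<omega> = r) = srw_mass s n"
      using rate_one_srw_point_prob[OF n(5) s, of r] by (simp add: n(1))
    have "srw_tail s n \<le> 2 * max (s / real n) 1 * srw_mass s n"
      by (rule order_trans[OF srw_tail_le_mass[OF n(3,2)]])
        (intro mult_right_mono, auto simp: srw_mass_pos[OF n(3), THEN less_imp_le])
    thus "exp (- 2) * max (s / real_of_int r) 1 \<le> \<P>(\<omega> in M. r \<le> X s \<omega>) / \<P>(\<omega> in M. X s \<omega> = r) \<and>
        \<P>(\<omega> in M. r \<le> X s \<omega>) / \<P>(\<omega> in M. X s \<omega> = r) \<le> 2 * max (s / real_of_int r) 1"
      using srw_tail_ge_mass[OF n(3,2,4)] srw_mass_pos[OF n(3), of n]
      unfolding tail point by (simp add: n(1) pos_le_divide_eq pos_divide_le_eq)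
  qed simp
qed

end
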